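(* Let $(R,P)$ be a unitary Rota-Baxter algebra of weight $\lambda\in\mathbb{K}$. If any ideal of $R_P$ is also an ideal of $R$, then the finite dual $(R^\circ,P^\ast)$ is a Rota-Baxter coalgebra of weight $\lambda$.
   Context: $\mathbb{K}$ is a fixed ground field of characteristic 0; all vector spaces, algebras, coalgebras and tensor products are over $\mathbb{K}$. A unitary Rota-Baxter algebra of weight $\lambda$ is a pair $(R,P)$ of a unital associative algebra $R$ and a linear endomorphism $P$ of $R$ with $P(x)P(y)=P(xP(y))+P(P(x)y)+\lambda P(xy)$ for all $x,y\in R$. $R_P$ denotes the vector space $R$ equipped with the double product $x\star_P y=xP(y)+P(x)y+\lambda xy$, which is an associative, not necessarily unital, algebra. Ideals are two-sided. For a unital algebra $(A,m,u)$ the finite dual is $A^\circ=\{f\in A^\ast\mid \ker f\text{ contains a cofinite ideal of }A\}$, where $A^\ast=\mathrm{Hom}_{\mathbb{K}}(A,\mathbb{K})$ and an ideal $I$ is cofinite if $\dim(A/I)<\infty$; $A^\circ$ is a coalgebra with comultiplication $\Delta=m^\ast$ (so $\langle\Delta(f),a\otimes b\rangle=f(ab)$) and counit $\varepsilon=u^\ast$ (so $\varepsilon(f)=f(1)$). $P^\ast:R^\ast\to R^\ast$ is $P^\ast(f)=f\circ P$; the conclusion includes that $P^\ast(R^\circ)\subset R^\circ$, and the operator on $R^\circ$ is the restriction of $P^\ast$. A Rota-Baxter coalgebra of weight $\lambda$ is a (coassociative, counital) coalgebra $(C,\Delta,\varepsilon)$ equipped with a linear operator $Q:C\to C$ such that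 $(Q\otimes Q)\Delta=(\mathrm{id}\otimes Q)\Delta Q+(Q\otimes\mathrm{id})\Delta Q+\lambda\Delta Q$. *)

theory Defs
  imports Main "HOL.Vector_Spaces" "HOL-Library.Function_Algebras"
begin

section \<open>Vector spaces with explicit carriers\<close>

text \<open>
  The finite dual and its tensor powers are not types, so a vector space is a subspace (the carrier)
  of an ambient space given by a type and a scalar multiplication.
\<close>

record ('k, 'v) vspace =
  vcarrier :: "'v set"
  vscale :: "'k \<Rightarrow> 'v \<Rightarrow> 'v"

definition vec_space :: "('k::field, 'v::ab_group_add) vspace \<Rightarrow> bool" where
  "vec_space V \<longleftrightarrow> vector_space (vscale V) \<and> module.subspace (vscale V) (vcarrier V)"

definition fscale :: "'k::field \<Rightarrow> ('x \<Rightarrow> 'k) \<Rightarrow> ('x \<Rightarrow> 'k)" where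
  "fscale c f = (\<lambda>x. c * f x)"

definition ground :: "('k::field, 'k) vspace" where
  "ground = \<lparr>vcarrier = UNIV, vscale = (*)\<rparr>"

definition linear_map ::
  "('k::field, 'v::ab_group_add) vspace \<Rightarrow> ('k, 'w::ab_group_add) vspace \<Rightarrow> ('v \<Rightarrow> 'w) \<Rightarrow> bool" where
  "linear_map V W f \<longleftrightarrow>
     (\<forall>x\<in>vcarrier V. f x \<in> vcarrier W) \<and>
     (\<forall>x\<in>vcarrier V. \<forall>y\<in>vcarrier V. f (x + y) = f x + f y) \<and>
     (\<forall>c. \<forall>x\<in>vcarrier V. f (vscale V c x) = vscale W c (f x))"

definition bilinear_map ::
  "('k::field, 'v::ab_group_add) vspace \<Rightarrow> ('k, 'w::ab_group_add) vspace \<Rightarrow>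
   ('k, 'x::ab_group_add) vspace \<Rightarrow> ('v \<Rightarrow> 'w \<Rightarrow> 'x) \<Rightarrow> bool" where
  "bilinear_map V W X \<beta> \<longleftrightarrow>
     (\<forall>v\<in>vcarrier V. linear_map W X (\<beta> v)) \<and>
     (\<forall>w\<in>vcarrier W. linear_map V X (\<lambda>v. \<beta> v w))"


section \<open>Tensor products\<close>

text \<open>
  \<open>V \<otimes> W\<close> is realised inside the dual of the space of bilinear forms on \<open>V \<times> W\<close>: the pure tensor
  of \<open>v\<close> and \<open>w\<close> is evaluation at \<open>(v, w)\<close>, and the tensor product is the span of the pure tensors.
  The universal property is proved below (\<open>tensor_universal\<close>, \<open>tensor_hom_eqI\<close>); everything
  else is defined through it and does not depend on this model.
\<close>

definition pure_tensor ::
  "('k::field, 'v::ab_group_add) vspace \<Rightarrow> ('k, 'w::ab_group_add) vspace \<Rightarrow>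
   'v \<Rightarrow> 'w \<Rightarrow> (('v \<Rightarrow> 'w \<Rightarrow> 'k) \<Rightarrow> 'k)" where
  "pure_tensor V W v w = (\<lambda>\<beta>. if bilinear_map V W ground \<beta> then \<beta> v w else 0)"

definition tensor ::
  "('k::field, 'v::ab_group_add) vspace \<Rightarrow> ('k, 'w::ab_group_add) vspace \<Rightarrow>
   ('k, ('v \<Rightarrow> 'w \<Rightarrow> 'k) \<Rightarrow> 'k) vspace" where
  "tensor V W =
     \<lparr>vcarrier = module.span fscale
        {pure_tensor V W v w | v w. v \<in> vcarrier V \<and> w \<in> vcarrier W},
      vscale = fscale\<rparr>"

text \<open>The linear map on \<open>V \<otimes> W\<close> induced by a bilinear map; it is determined on the carrier only.\<close>

definition tensor_lift ::
  "('k::field, 'v::ab_group_add) vspace \<Rightarrow> ('k, 'w::ab_group_add) vspace \<Rightarrow>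
   ('k, 'x::ab_group_add) vspace \<Rightarrow> ('v \<Rightarrow> 'w \<Rightarrow> 'x) \<Rightarrow> ((('v \<Rightarrow> 'w \<Rightarrow> 'k) \<Rightarrow> 'k) \<Rightarrow> 'x)" where
  "tensor_lift V W X \<beta> =
     (SOME L. linear_map (tensor V W) X L \<and>
        (\<forall>v\<in>vcarrier V. \<forall>w\<in>vcarrier W. L (pure_tensor V W v w) = \<beta> v w))"

text \<open>\<open>f \<otimes> g : V \<otimes> W \<rightarrow> V' \<otimes> W'\<close>.\<close>

definition tensor_map ::
  "('k::field, 'v::ab_group_add) vspace \<Rightarrow> ('k, 'w::ab_group_add) vspace \<Rightarrow>
   ('k, 'v2::ab_group_add) vspace \<Rightarrow> ('k, 'w2::ab_group_add) vspace \<Rightarrow>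
   ('v \<Rightarrow> 'v2) \<Rightarrow> ('w \<Rightarrow> 'w2) \<Rightarrow>
   ((('v \<Rightarrow> 'w \<Rightarrow> 'k) \<Rightarrow> 'k) \<Rightarrow> (('v2 \<Rightarrow> 'w2 \<Rightarrow> 'k) \<Rightarrow> 'k))" where
  "tensor_map V W V' W' f g =
     tensor_lift V W (tensor V' W') (\<lambda>v w. pure_tensor V' W' (f v) (g w))"

text \<open>The canonical isomorphism \<open>(V \<otimes> W) \<otimes> X \<rightarrow> V \<otimes> (W \<otimes> X)\<close>.\<close>

definition tensor_assoc ::
  "('k::field, 'v::ab_group_add) vspace \<Rightarrow> ('k, 'w::ab_group_add) vspace \<Rightarrow>
   ('k, 'x::ab_group_add) vspace \<Rightarrow>
   (((('v \<Rightarrow> 'w \<Rightarrow> 'k) \<Rightarrow> 'k) \<Rightarrow> 'x \<Rightarrow> 'k) \<Rightarrow> 'k) \<Rightarrow>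
   (('v \<Rightarrow> (('w \<Rightarrow> 'x \<Rightarrow> 'k) \<Rightarrow> 'k) \<Rightarrow> 'k) \<Rightarrow> 'k)" where
  "tensor_assoc V W X =
     tensor_lift (tensor V W) X (tensor V (tensor W X))
       (\<lambda>t x. tensor_lift V W (tensor V (tensor W X))
                (\<lambda>v w. pure_tensor V (tensor W X) v (pure_tensor W X w x)) t)"

lemma fscale_apply [simp]: "fscale c f x = c * f x"
  by (simp add: fscale_def)

lemma vector_space_fscale: "vector_space (fscale :: 'k::field \<Rightarrow> ('x \<Rightarrow> 'k) \<Rightarrow> _)"
  by unfold_locales (auto simp: fun_eq_iff algebra_simps)

lemma module_fscale: "module (fscale :: 'k::field \<Rightarrow> ('x \<Rightarrow> 'k) \<Rightarrow> _)"
  using module_iff_vector_space vector_space_fscale by blast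

lemma vector_space_ground: "vector_space ((*) :: 'k::field \<Rightarrow> 'k \<Rightarrow> 'k)"
  by unfold_locales (auto simp: algebra_simps)

lemma vec_space_ground: "vec_space ground"
  using module_iff_vector_space vector_space_ground
  by (auto simp: vec_space_def ground_def intro!: module.subspace_UNIV)

lemma vec_space_tensor: "vec_space (tensor V W)"
  by (simp add: vec_space_def tensor_def vector_space_fscale module.subspace_span[OF module_fscale])

lemma vscale_tensor [simp]: "vscale (tensor V W) = fscale"
  by (simp add: tensor_def)

lemma vec_space_closed:
  assumes "vec_space V"
  shows "0 \<in> vcarrier V"
    and "x \<in> vcarrier V \<Longrightarrow> y \<in> vcarrier V \<Longrightarrow> x + y \<in> vcarrier V"
    and "x \<in> vcarrier V \<Longrightarrow> vscale V c x \<in> vcarrier V"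
proof -
  interpret vector_space "vscale V" using assms by (simp add: vec_space_def)
  have S: "subspace (vcarrier V)" using assms by (simp add: vec_space_def)
  show "0 \<in> vcarrier V" using S by (rule subspace_0)
  show "x \<in> vcarrier V \<Longrightarrow> y \<in> vcarrier V \<Longrightarrow> x + y \<in> vcarrier V"
    using S by (rule subspace_add)
  show "x \<in> vcarrier V \<Longrightarrow> vscale V c x \<in> vcarrier V"
    using S by (rule subspace_scale)
qed

lemma pure_tensor_mem:
  "v \<in> vcarrier V \<Longrightarrow> w \<in> vcarrier W \<Longrightarrow> pure_tensor V W v w \<in> vcarrier (tensor V W)"
  unfolding tensor_def by (auto intro!: module.span_base[OF module_fscale])

lemma bilinear_pure_tensor: "bilinear_map V W (tensor V W) (pure_tensor V W)"
  unfolding bilinear_map_def linear_map_def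
  using pure_tensor_mem
  by (auto simp: pure_tensor_def fun_eq_iff bilinear_map_def linear_map_def ground_def)

lemma tensor_induct [consumes 1, case_names zero add]:
  assumes t: "t \<in> vcarrier (tensor V W)"
    and zero: "Q 0"
    and add: "\<And>c v w t. v \<in> vcarrier V \<Longrightarrow> w \<in> vcarrier W \<Longrightarrow>
                t \<in> vcarrier (tensor V W) \<Longrightarrow> Q t \<Longrightarrow> Q (fscale c (pure_tensor V W v w) + t)"
  shows "Q t"
proof -
  let ?S = "{pure_tensor V W v w | v w. v \<in> vcarrier V \<and> w \<in> vcarrier W}"
  have "t \<in> module.span fscale ?S" using t by (simp add: tensor_def)
  then have "t \<in> vcarrier (tensor V W) \<and> Q t"
  proof (induction rule: module.span_induct_alt[OF module_fscale, consumes 1])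
    case 1
    show ?case using vec_space_closed(1)[OF vec_space_tensor[of V W]] zero by (rule conjI)
  next
    case (2 c x y)
    then obtain v w where vw: "x = pure_tensor V W v w" "v \<in> vcarrier V" "w \<in> vcarrier W" by blast
    have "fscale c x \<in> vcarrier (tensor V W)"
      using vec_space_closed(3)[OF vec_space_tensor[of V W] pure_tensor_mem[OF vw(2,3)], of c] vw(1)
      by simp
    then show ?case
      using 2 vw add vec_space_closed(2)[OF vec_space_tensor[of V W]] by blast
  qed
  then show ?thesis by blast
qed

lemma tensor_hom_eqI:
  assumes L: "linear_map (tensor V W) X L" and M: "linear_map (tensor V W) X M"
    and X: "vec_space X"
    and eq: "\<And>v w. v \<in> vcarrier V \<Longrightarrow> w \<in> vcarrier W \<Longrightarrow>
               L (pure_tensor V W v w) = M (pure_tensor V W v w)"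
    and t: "t \<in> vcarrier (tensor V W)"
  shows "L t = M t"
  using t
proof (induction rule: tensor_induct)
  case zero
  have "(0::_ \<Rightarrow> 'a) \<in> vcarrier (tensor V W)" using vec_space_closed(1)[OF vec_space_tensor] .
  then have "L (0 + 0) = L 0 + L 0" "M (0 + 0) = M 0 + M 0"
    using L M unfolding linear_map_def by blast+
  then have "L 0 = M 0" by simp
  then show ?case .
next
  case (add c v w t)
  have p: "pure_tensor V W v w \<in> vcarrier (tensor V W)" using add pure_tensor_mem by blast
  then have q: "fscale c (pure_tensor V W v w) \<in> vcarrier (tensor V W)"
    using vec_space_closed(3)[OF vec_space_tensor[of V W] p, of c] by simp
  have "L (fscale c (pure_tensor V W v w) + t) = vscale X c (L (pure_tensor V W v w)) + L t"
    using L p q add(3) unfolding linear_map_def by (metis vscale_tensor)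
  moreover have "M (fscale c (pure_tensor V W v w) + t) = vscale X c (M (pure_tensor V W v w)) + M t"
    using M p q add(3) unfolding linear_map_def by (metis vscale_tensor)
  moreover have "L (pure_tensor V W v w) = M (pure_tensor V W v w)" using add eq by blast
  ultimately have "L (fscale c (pure_tensor V W v w) + t) = M (fscale c (pure_tensor V W v w) + t)"
    using add(4) by metis
  then show ?case .
qed

lemma linear_forms_separate:
  assumes "vector_space s" and "\<And>\<phi>. Vector_Spaces.linear s ((*) :: 'k::field \<Rightarrow> _) \<phi> \<Longrightarrow> \<phi> x = \<phi> y"
  shows "x = y"
proof (rule ccontr)
  assume "x \<noteq> y"
  interpret vector_space s by fact
  interpret p: vector_space_pair s "(*) :: 'k \<Rightarrow> _"
    using assms(1) vector_space_ground by (simp add: vector_space_pair_def)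
  have "independent {x - y}" using \<open>x \<noteq> y\<close> by simp
  then obtain \<phi> where "Vector_Spaces.linear s (*) \<phi>" "\<forall>z\<in>{x - y}. \<phi> z = 1"
    using p.linear_independent_extend[of "{x - y}" "\<lambda>_. 1"] by blast
  moreover have "\<phi> (x - y) = \<phi> x - \<phi> y"
    using calculation(1) p.linear_diff by blast
  ultimately show False using assms(2)[of \<phi>] by simp
qed

theorem tensor_universal:
  assumes X: "vec_space X" and \<beta>: "bilinear_map V W X \<beta>"
  shows "\<exists>L. linear_map (tensor V W) X L \<and>
           (\<forall>v\<in>vcarrier V. \<forall>w\<in>vcarrier W. L (pure_tensor V W v w) = \<beta> v w)"
proof -
  let ?lin = "Vector_Spaces.linear (vscale X) (*)"
  let ?T = "vcarrier (tensor V W)"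
  define rel where
    "rel t e \<longleftrightarrow> e \<in> vcarrier X \<and> (\<forall>\<phi>. ?lin \<phi> \<longrightarrow> t (\<lambda>v w. \<phi> (\<beta> v w)) = \<phi> e)" for t e
  have vs: "vector_space (vscale X)" using X by (simp add: vec_space_def)
  have linD: "\<phi> (a + b) = \<phi> a + \<phi> b" "\<phi> (vscale X c a) = c * \<phi> a" "\<phi> 0 = 0" if "?lin \<phi>" for \<phi> a b c
    using that Vector_Spaces.linear_iff[of "vscale X" "(*)" \<phi>]
    by (auto, metis add_cancel_right_right)
  have bil: "bilinear_map V W ground (\<lambda>v w. \<phi> (\<beta> v w))" if "?lin \<phi>" for \<phi>
    using \<beta> linD[OF that] unfolding bilinear_map_def linear_map_def by (simp add: ground_def)
  have rel_pure: "rel (pure_tensor V W v w) (\<beta> v w)" if "v \<in> vcarrier V" "w \<in> vcarrier W" for v w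
  proof -
    have "\<beta> v w \<in> vcarrier X" using that \<beta> by (simp add: bilinear_map_def linear_map_def)
    then show ?thesis using bil by (simp add: rel_def pure_tensor_def)
  qed
  have rel_add: "rel (s + t) (d + e)" if "rel s d" "rel t e" for s t d e
    using that linD vec_space_closed[OF X] by (auto simp: rel_def)
  have rel_scale: "rel (fscale c t) (vscale X c e)" if "rel t e" for c t e
    using that linD vec_space_closed[OF X] by (auto simp: rel_def)
  have rel_unique: "d = e" if "rel t d" "rel t e" for t d e
    using that by (intro linear_forms_separate[OF vs]) (auto simp: rel_def)
  have ex: "\<exists>e. rel t e" if "t \<in> ?T" for t
    using that
  proof (induction rule: tensor_induct)
    case zero
    have "rel 0 0" using linD vec_space_closed[OF X] by (auto simp: rel_def)
    then show ?case ..
  next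
    case (add c v w t)
    then show ?case using rel_add rel_scale rel_pure by blast
  qed
  define L where "L t = (THE e. rel t e)" for t
  have L: "L t = e" if "rel t e" for t e
    using that rel_unique unfolding L_def by blast
  have rL: "rel t (L t)" if "t \<in> ?T" for t using ex[OF that] L by blast
  have "linear_map (tensor V W) X L"
    unfolding linear_map_def
  proof (intro conjI ballI allI)
    fix t assume "t \<in> ?T"
    then show "L t \<in> vcarrier X" using rL by (auto simp: rel_def)
  next
    fix s t assume "s \<in> ?T" "t \<in> ?T"
    then show "L (s + t) = L s + L t" using rL rel_add L by blast
  next
    fix c t assume "t \<in> ?T"
    then show "L (vscale (tensor V W) c t) = vscale X c (L t)" using rL rel_scale L by fastforce
  qed
  then show ?thesis using rel_pure L by blast
qed

lemma tensor_lift: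
  assumes "vec_space X" and "bilinear_map V W X \<beta>"
  shows linear_tensor_lift: "linear_map (tensor V W) X (tensor_lift V W X \<beta>)"
    and tensor_lift_pure:
      "v \<in> vcarrier V \<Longrightarrow> w \<in> vcarrier W \<Longrightarrow> tensor_lift V W X \<beta> (pure_tensor V W v w) = \<beta> v w"
  using someI_ex[OF tensor_universal[OF assms]] unfolding tensor_lift_def by blast+


section \<open>Coalgebras\<close>

text \<open>
  In the counit laws \<open>K \<otimes> C\<close> and \<open>C \<otimes> K\<close> are identified with \<open>C\<close>, so that \<open>\<epsilon> \<otimes> id\<close> becomes the map
  sending a pure tensor of \<open>x\<close> and \<open>y\<close> to \<open>\<epsilon>(x) y\<close>.
\<close>

locale coalgebra =
  fixes C :: "('k::field, 'c::ab_group_add) vspace"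
    and \<Delta> :: "'c \<Rightarrow> (('c \<Rightarrow> 'c \<Rightarrow> 'k) \<Rightarrow> 'k)"
    and \<epsilon> :: "'c \<Rightarrow> 'k"
  assumes vec_space: "vec_space C"
    and comult_linear: "linear_map C (tensor C C) \<Delta>"
    and counit_linear: "linear_map C ground \<epsilon>"
    and coassociative: "x \<in> vcarrier C \<Longrightarrow>
      tensor_assoc C C C (tensor_map C C (tensor C C) C \<Delta> id (\<Delta> x)) =
      tensor_map C C C (tensor C C) id \<Delta> (\<Delta> x)"
    and counit_left: "x \<in> vcarrier C \<Longrightarrow>
      tensor_lift C C C (\<lambda>y z. vscale C (\<epsilon> y) z) (\<Delta> x) = x"
    and counit_right: "x \<in> vcarrier C \<Longrightarrow>
      tensor_lift C C C (\<lambda>y z. vscale C (\<epsilon> z) y) (\<Delta> x) = x"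

locale rota_baxter_coalgebra = coalgebra C \<Delta> \<epsilon>
  for C :: "('k::field, 'c::ab_group_add) vspace" and \<Delta> and \<epsilon> +
  fixes Q :: "'c \<Rightarrow> 'c" and wt :: 'k
  assumes operator_linear: "linear_map C C Q"
    and rota_baxter: "x \<in> vcarrier C \<Longrightarrow>
      tensor_map C C C C Q Q (\<Delta> x) =
      tensor_map C C C C id Q (\<Delta> (Q x)) + tensor_map C C C C Q id (\<Delta> (Q x)) + fscale wt (\<Delta> (Q x))"


section \<open>Algebras, ideals and the finite dual\<close>

text \<open>The sort \<open>{ring, monoid_mult}\<close> is used rather than \<open>ring_1\<close> so that the zero algebra is allowed.\<close>

locale unital_algebra = vector_space scale
  for scale :: "'k::field \<Rightarrow> 'r::{ring, monoid_mult} \<Rightarrow> 'r" +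
  assumes scale_mult_left: "scale c x * y = scale c (x * y)"
    and scale_mult_right: "x * scale c y = scale c (x * y)"

locale rota_baxter_algebra = unital_algebra scale
  for scale :: "'k::field \<Rightarrow> 'r::{ring, monoid_mult} \<Rightarrow> 'r" +
  fixes P :: "'r \<Rightarrow> 'r" and wt :: 'k
  assumes P_linear: "Vector_Spaces.linear scale scale P"
    and rota_baxter: "P x * P y = P (x * P y) + P (P x * y) + scale wt (P (x * y))"

definition double_product ::
  "('k \<Rightarrow> 'r::{ring, monoid_mult} \<Rightarrow> 'r) \<Rightarrow> ('r \<Rightarrow> 'r) \<Rightarrow> 'k \<Rightarrow> 'r \<Rightarrow> 'r \<Rightarrow> 'r" where
  "double_product scale P l x y = x * P y + P x * y + scale l (x * y)"

text \<open>
  The multiplication is a parameter because ideals are needed both for \<open>(*)\<close> and for the double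
  product; for an algebra without unit an ideal has to be required to be a linear subspace.
\<close>

definition algebra_ideal ::
  "('k::field \<Rightarrow> 'r::ab_group_add \<Rightarrow> 'r) \<Rightarrow> ('r \<Rightarrow> 'r \<Rightarrow> 'r) \<Rightarrow> 'r set \<Rightarrow> bool" where
  "algebra_ideal scale mult I \<longleftrightarrow>
     module.subspace scale I \<and> (\<forall>a. \<forall>x\<in>I. mult a x \<in> I \<and> mult x a \<in> I)"

text \<open>\<open>dim (A / I) < \<infinity>\<close>: the classes of finitely many elements span \<open>A / I\<close>.\<close>

definition finite_codimension ::
  "('k::field \<Rightarrow> 'r::ab_group_add \<Rightarrow> 'r) \<Rightarrow> 'r set \<Rightarrow> bool" where
  "finite_codimension scale I \<longleftrightarrow> (\<exists>B. finite B \<and> (\<forall>x. \<exists>b\<in>module.span scale B. x - b \<in> I))"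

definition finite_dual ::
  "('k::field \<Rightarrow> 'r::{ring, monoid_mult} \<Rightarrow> 'r) \<Rightarrow> ('k, 'r \<Rightarrow> 'k) vspace" where
  "finite_dual scale =
     \<lparr>vcarrier = {f. Vector_Spaces.linear scale (*) f \<and>
        (\<exists>I. algebra_ideal scale (*) I \<and> finite_codimension scale I \<and> I \<subseteq> {x. f x = 0})},
      vscale = fscale\<rparr>"

text \<open>\<open>\<langle>t, a \<otimes> b\<rangle>\<close>, where \<open>\<langle>g \<otimes> h, a \<otimes> b\<rangle> = g(a) h(b)\<close>.\<close>

definition finite_dual_pairing ::
  "('k::field \<Rightarrow> 'r::{ring, monoid_mult} \<Rightarrow> 'r) \<Rightarrow>
   ((('r \<Rightarrow> 'k) \<Rightarrow> ('r \<Rightarrow> 'k) \<Rightarrow> 'k) \<Rightarrow> 'k) \<Rightarrow> 'r \<Rightarrow> 'r \<Rightarrow> 'k" where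
  "finite_dual_pairing scale t a b =
     tensor_lift (finite_dual scale) (finite_dual scale) ground (\<lambda>g h. g a * h b) t"

text \<open>
  Existence and uniqueness of the element described here are proved at the end of this theory
  (\<open>finite_dual_comult_exists\<close>, \<open>finite_dual_pairing_inject\<close>).
\<close>

definition finite_dual_comult ::
  "('k::field \<Rightarrow> 'r::{ring, monoid_mult} \<Rightarrow> 'r) \<Rightarrow>
   ('r \<Rightarrow> 'k) \<Rightarrow> ((('r \<Rightarrow> 'k) \<Rightarrow> ('r \<Rightarrow> 'k) \<Rightarrow> 'k) \<Rightarrow> 'k)" where
  "finite_dual_comult scale f =
     (THE t. t \<in> vcarrier (tensor (finite_dual scale) (finite_dual scale)) \<and>
        (\<forall>a b. finite_dual_pairing scale t a b = f (a * b)))"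

definition finite_dual_counit :: "('r::{ring, monoid_mult} \<Rightarrow> 'k::field) \<Rightarrow> 'k" where
  "finite_dual_counit f = f 1"

definition dual_operator :: "('r \<Rightarrow> 'r) \<Rightarrow> ('r \<Rightarrow> 'k) \<Rightarrow> ('r \<Rightarrow> 'k)" where
  "dual_operator P f = f \<circ> P"

section \<open>The comultiplication of the finite dual is well defined\<close>

lemma linear_mapD:
  assumes "linear_map V W f"
  shows "x \<in> vcarrier V \<Longrightarrow> f x \<in> vcarrier W"
    and "x \<in> vcarrier V \<Longrightarrow> y \<in> vcarrier V \<Longrightarrow> f (x + y) = f x + f y"
    and "x \<in> vcarrier V \<Longrightarrow> f (vscale V c x) = vscale W c (f x)"
  using assms by (auto simp: linear_map_def)

lemma linear_map_zero:
  assumes "linear_map V W f" "vec_space V"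
  shows "f 0 = 0"
proof -
  have "f (0 + 0) = f 0 + f 0"
    using linear_mapD(2)[OF assms(1)] vec_space_closed(1)[OF assms(2)] by blast
  then show ?thesis by simp
qed

lemma vec_space_sum:
  assumes "vec_space V" "\<And>i. i \<in> A \<Longrightarrow> g i \<in> vcarrier V"
  shows "(\<Sum>i\<in>A. g i) \<in> vcarrier V"
  using assms(2) by (induction A rule: infinite_finite_induct) (auto intro: vec_space_closed[OF assms(1)])

lemma linear_map_sum:
  assumes f: "linear_map V W f" and V: "vec_space V" and "\<And>i. i \<in> A \<Longrightarrow> g i \<in> vcarrier V"
  shows "f (\<Sum>i\<in>A. g i) = (\<Sum>i\<in>A. f (g i))"
  using assms(3)
proof (induction A rule: infinite_finite_induct)
  case (insert x F)
  then show ?case using linear_mapD(2)[OF f] vec_space_sum[OF V, of F g] by simp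
qed (simp_all add: linear_map_zero[OF f V])

lemma sum_fun_apply: "(\<Sum>i\<in>A. g i) x = (\<Sum>i\<in>A. g i x)"
  for g :: "'i \<Rightarrow> 'x \<Rightarrow> 'k::comm_monoid_add"
  by (induction A rule: infinite_finite_induct) auto

lemma finite_codimension_coordinates:
  fixes scale :: "'k::field \<Rightarrow> 'r::ab_group_add \<Rightarrow> 'r"
  assumes "vector_space scale" and I: "module.subspace scale I" and "finite_codimension scale I"
  obtains B h where "finite B" and "\<forall>b\<in>B. Vector_Spaces.linear scale (*) (h b)"
    and "\<forall>b\<in>B. \<forall>x\<in>I. h b x = 0"
    and "\<forall>x. x - (\<Sum>b\<in>B. scale (h b x) b) \<in> I"
proof -
  interpret vector_space scale by fact
  obtain D where D: "finite D" "\<And>x. \<exists>b\<in>span D. x - b \<in> I"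
    using assms(3) unfolding finite_codimension_def by blast
  obtain E where E: "E \<subseteq> I" "independent E" "I \<subseteq> span E"
    using maximal_independent_subset[of I] by blast
  obtain F where F: "E \<subseteq> F" "F \<subseteq> E \<union> D" "independent F" "E \<union> D \<subseteq> span F"
    using maximal_independent_subset_extend[of E "E \<union> D"] E by blast
  have IE: "span E = I" using E I by (metis span_subspace)
  have "x \<in> span F" for x
  proof -
    obtain b where b: "b \<in> span D" "x - b \<in> I" using D by blast
    have "span D \<subseteq> span F" "span E \<subseteq> span F"
      using F(4) span_minimal[OF _ subspace_span] by blast+
    then have "b + (x - b) \<in> span F" using b IE by (intro span_add) auto
    then show ?thesis by simp
  qed
  then have spF: "span F = UNIV" by auto
  define h where "h b x = representation F x b" for b x
  show ?thesis
  proof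
    show "finite (F - E)" by (rule finite_subset[OF _ D(1)]) (use F(2) in auto)
    show "\<forall>b\<in>F - E. Vector_Spaces.linear scale (*) (h b)"
      unfolding linear_iff h_def
      using F(3) spF vector_space_axioms vector_space_ground
      by (auto simp: representation_add representation_scale)
    show "\<forall>b\<in>F - E. \<forall>x\<in>I. h b x = 0"
    proof (intro ballI)
      fix b x assume *: "b \<in> F - E" "x \<in> I"
      then have "representation F x b = representation E x b"
        using representation_extend[OF F(3) _ F(1), of x] IE by simp
      then show "h b x = 0"
        using representation_ne_zero[of E x b] * unfolding h_def by auto
    qed
    show "\<forall>x. x - (\<Sum>b\<in>F - E. scale (h b x) b) \<in> I"
    proof
      fix x
      let ?S = "{b. representation F x b \<noteq> 0}"
      have fin: "finite ?S" by (rule finite_representation)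
      have sub: "?S \<subseteq> F" using representation_ne_zero by auto
      have "x = (\<Sum>b\<in>?S. scale (h b x) b)"
        unfolding h_def using sum_nonzero_representation_eq[OF F(3), of x] spF by simp
      also have "\<dots> = (\<Sum>b\<in>?S \<inter> E. scale (h b x) b) + (\<Sum>b\<in>?S - E. scale (h b x) b)"
        using fin by (rule sum.Int_Diff)
      also have "(\<Sum>b\<in>?S - E. scale (h b x) b) = (\<Sum>b\<in>F - E. scale (h b x) b)"
        using \<open>finite (F - E)\<close> sub by (intro sum.mono_neutral_left) (auto simp: h_def)
      finally have "x - (\<Sum>b\<in>F - E. scale (h b x) b) = (\<Sum>b\<in>?S \<inter> E. scale (h b x) b)"
        by (simp add: diff_eq_eq)
      also have "\<dots> \<in> span E" by (intro span_sum span_scale span_base) auto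
      finally show "x - (\<Sum>b\<in>F - E. scale (h b x) b) \<in> I" using IE by simp
    qed
  qed
qed

lemma finite_codimension_functionals:
  fixes scale :: "'k::field \<Rightarrow> 'r::ab_group_add \<Rightarrow> 'r"
  assumes "vector_space scale" and "finite \<Phi>"
    and "\<And>\<phi>. \<phi> \<in> \<Phi> \<Longrightarrow> Vector_Spaces.linear scale (*) \<phi>"
    and "{x. \<forall>\<phi>\<in>\<Phi>. \<phi> x = 0} \<subseteq> I"
  shows "finite_codimension scale I"
proof -
  interpret vector_space scale by fact
  have "finite_codimension scale {x. \<forall>\<phi>\<in>\<Phi>. \<phi> x = 0}"
    using assms(2,3)
  proof (induction \<Phi> rule: finite_induct)
    case empty
    show ?case unfolding finite_codimension_def by (intro exI[of _ "{}"]) auto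
  next
    case (insert \<phi> \<Phi>)
    let ?K = "{x. \<forall>\<phi>\<in>\<Phi>. \<phi> x = 0}"
    have lin: "\<psi> (x + y) = \<psi> x + \<psi> y" "\<psi> (scale c x) = c * \<psi> x" "\<psi> (x - y) = \<psi> x - \<psi> y"
      if "\<psi> \<in> insert \<phi> \<Phi>" for \<psi> x y c
    proof -
      interpret l: Vector_Spaces.linear scale "(*)" \<psi> using insert that by blast
      show "\<psi> (x + y) = \<psi> x + \<psi> y" "\<psi> (scale c x) = c * \<psi> x" "\<psi> (x - y) = \<psi> x - \<psi> y"
        by (simp_all add: l.add l.scale l.diff)
    qed
    obtain B where B: "finite B" "\<And>x. \<exists>b\<in>span B. x - b \<in> ?K"
      using insert unfolding finite_codimension_def by blast
    show ?case
    proof (cases "\<forall>x\<in>?K. \<phi> x = 0")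
      case True
      then have "{x. \<forall>\<phi>\<in>insert \<phi> \<Phi>. \<phi> x = 0} = ?K" by auto
      then show ?thesis using insert by simp
    next
      case False
      then obtain k where k: "k \<in> ?K" "\<phi> k \<noteq> 0" by blast
      have "\<exists>b\<in>span (insert k B). x - b \<in> {x. \<forall>\<phi>\<in>insert \<phi> \<Phi>. \<phi> x = 0}" for x
      proof -
        obtain b where b: "b \<in> span B" "x - b \<in> ?K" using B by blast
        let ?b = "b + scale (\<phi> (x - b) / \<phi> k) k"
        have "?b \<in> span (insert k B)"
        proof (intro span_add span_scale)
          show "b \<in> span (insert k B)" using b(1) span_mono[of B "insert k B"] by blast
          show "k \<in> span (insert k B)" by (simp add: span_base)
        qed
        moreover have "\<psi> (x - ?b) = 0" if "\<psi> \<in> insert \<phi> \<Phi>" for \<psi>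
        proof -
          have "\<psi> (x - ?b) = \<psi> (x - b) - (\<phi> (x - b) / \<phi> k) * \<psi> k"
            using lin[OF that] by simp
          then show ?thesis using that b(2) k by auto
        qed
        ultimately show ?thesis by blast
      qed
      then show ?thesis using B(1) unfolding finite_codimension_def by (meson finite.insertI)
    qed
  qed
  then obtain B where B: "finite B" "\<forall>x. \<exists>b\<in>span B. x - b \<in> {x. \<forall>\<phi>\<in>\<Phi>. \<phi> x = 0}"
    unfolding finite_codimension_def by blast
  have "\<exists>b\<in>span B. x - b \<in> I" for x
    using B(2)[rule_format, of x] assms(4) by (elim bexE, intro bexI) (rule subsetD)
  then show ?thesis using B(1) unfolding finite_codimension_def by (intro exI[of _ B] conjI allI)
qed

lemma finite_codimension_Int:
  fixes scale :: "'k::field \<Rightarrow> 'r::ab_group_add \<Rightarrow> 'r"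
  assumes vs: "vector_space scale"
    and I: "module.subspace scale I" "finite_codimension scale I"
    and J: "module.subspace scale J" "finite_codimension scale J"
  shows "finite_codimension scale (I \<inter> J)"
proof -
  interpret vector_space scale by fact
  have *: "\<exists>\<Phi>. finite \<Phi> \<and> (\<forall>\<phi>\<in>\<Phi>. Vector_Spaces.linear scale (*) \<phi>) \<and> {x. \<forall>\<phi>\<in>\<Phi>. \<phi> x = 0} \<subseteq> K"
    if K: "module.subspace scale K" "finite_codimension scale K" for K
  proof -
    obtain B h where B: "finite B" "\<forall>b\<in>B. Vector_Spaces.linear scale (*) (h b)"
      "\<forall>b\<in>B. \<forall>x\<in>K. h b x = 0" "\<forall>x. x - (\<Sum>b\<in>B. scale (h b x) b) \<in> K"
      by (rule finite_codimension_coordinates[OF vs K])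
    have "x \<in> K" if "\<forall>b\<in>B. h b x = 0" for x
      using B(4)[rule_format, of x] that by simp
    then show ?thesis using B by (intro exI[of _ "h ` B"]) auto
  qed
  obtain \<Phi> where \<Phi>: "finite \<Phi>" "\<forall>\<phi>\<in>\<Phi>. Vector_Spaces.linear scale (*) \<phi>" "{x. \<forall>\<phi>\<in>\<Phi>. \<phi> x = 0} \<subseteq> I"
    using *[OF I] by blast
  obtain \<Psi> where \<Psi>: "finite \<Psi>" "\<forall>\<phi>\<in>\<Psi>. Vector_Spaces.linear scale (*) \<phi>" "{x. \<forall>\<phi>\<in>\<Psi>. \<phi> x = 0} \<subseteq> J"
    using *[OF J] by blast
  from \<Phi> \<Psi> show ?thesis
    by (intro finite_codimension_functionals[OF vs, of "\<Phi> \<union> \<Psi>"]) auto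
qed

lemma linear_mem:
  assumes "Vector_Spaces.linear scale (*) f"
  shows "f (x + y) = f x + f y" "f (scale c x) = c * f x" "f 0 = 0" "f (x - y) = f x - f y"
    "f (\<Sum>i\<in>A. g i) = (\<Sum>i\<in>A. f (g i))"
proof -
  interpret Vector_Spaces.linear scale "(*)" f by fact
  show "f (x + y) = f x + f y" "f (scale c x) = c * f x" "f 0 = 0" "f (x - y) = f x - f y"
    "f (\<Sum>i\<in>A. g i) = (\<Sum>i\<in>A. f (g i))"
    by (simp_all add: add scale diff sum)
qed

lemma vscale_finite_dual [simp]: "vscale (finite_dual scale) = fscale"
  by (simp add: finite_dual_def)

lemma finite_dualI:
  assumes "Vector_Spaces.linear scale (*) f" "algebra_ideal scale (*) I"
    "finite_codimension scale I" "\<And>x. x \<in> I \<Longrightarrow> f x = 0"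
  shows "f \<in> vcarrier (finite_dual scale)"
  using assms unfolding finite_dual_def by auto

context unital_algebra
begin

abbreviation "R0 \<equiv> finite_dual scale"

lemma finite_dual_ideal:
  assumes "f \<in> vcarrier R0"
  obtains I where "Vector_Spaces.linear scale (*) f" "algebra_ideal scale (*) I"
    "finite_codimension scale I" "\<forall>x\<in>I. f x = 0"
  using assms unfolding finite_dual_def by auto

lemma finite_dual_linear: "f \<in> vcarrier R0 \<Longrightarrow> Vector_Spaces.linear scale (*) f"
  by (simp add: finite_dual_def)

lemma vec_space_finite_dual: "vec_space R0"
proof -
  interpret F: vector_space "fscale :: 'k \<Rightarrow> ('r \<Rightarrow> 'k) \<Rightarrow> _" by (rule vector_space_fscale)
  have "F.subspace (vcarrier R0)"
  proof (rule F.subspaceI)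
    have "Vector_Spaces.linear scale (*) (0 :: 'r \<Rightarrow> 'k)"
      by (simp add: linear_iff vector_space_axioms vector_space_ground)
    moreover have "finite_codimension scale UNIV"
      unfolding finite_codimension_def by (intro exI[of _ "{}"]) auto
    ultimately show "0 \<in> vcarrier R0"
      by (intro finite_dualI[of _ _ UNIV]) (auto simp: algebra_ideal_def)
  next
    fix f g assume "f \<in> vcarrier R0" "g \<in> vcarrier R0"
    obtain I where f: "Vector_Spaces.linear scale (*) f" "algebra_ideal scale (*) I"
      "finite_codimension scale I" "\<forall>x\<in>I. f x = 0"
      using \<open>f \<in> vcarrier R0\<close> by (rule finite_dual_ideal)
    obtain J where g: "Vector_Spaces.linear scale (*) g" "algebra_ideal scale (*) J"
      "finite_codimension scale J" "\<forall>x\<in>J. g x = 0"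
      using \<open>g \<in> vcarrier R0\<close> by (rule finite_dual_ideal)
    show "f + g \<in> vcarrier R0"
    proof (rule finite_dualI[of _ _ "I \<inter> J"])
      show "Vector_Spaces.linear scale (*) (f + g)"
        using f(1) g(1) by (simp add: linear_iff algebra_simps)
      show "algebra_ideal scale (*) (I \<inter> J)"
        using f(2) g(2) by (simp add: algebra_ideal_def subspace_inter)
      show "finite_codimension scale (I \<inter> J)"
        using f g vector_space_axioms by (intro finite_codimension_Int) (auto simp: algebra_ideal_def)
    qed (use f g in auto)
  next
    fix c f assume "f \<in> vcarrier R0"
    then obtain I where f: "Vector_Spaces.linear scale (*) f" "algebra_ideal scale (*) I"
      "finite_codimension scale I" "\<forall>x\<in>I. f x = 0"
      by (rule finite_dual_ideal)
    show "fscale c f \<in> vcarrier R0"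
    proof (rule finite_dualI[of _ _ I])
      show "Vector_Spaces.linear scale (*) (fscale c f)"
        using f(1) by (simp add: linear_iff algebra_simps)
    qed (use f in auto)
  qed
  then show ?thesis by (simp add: vec_space_def vector_space_fscale)
qed

lemma bilinear_evaluation: "bilinear_map R0 R0 ground (\<lambda>g h. g a * h b)"
  unfolding bilinear_map_def linear_map_def by (auto simp: ground_def algebra_simps)

lemma linear_finite_dual_pairing:
  "linear_map (tensor R0 R0) ground (\<lambda>t. finite_dual_pairing scale t a b)"
  unfolding finite_dual_pairing_def
  by (rule linear_tensor_lift[OF vec_space_ground bilinear_evaluation])

lemma finite_dual_pairing_pure:
  "g \<in> vcarrier R0 \<Longrightarrow> h \<in> vcarrier R0 \<Longrightarrow>
   finite_dual_pairing scale (pure_tensor R0 R0 g h) a b = g a * h b"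
  unfolding finite_dual_pairing_def
  by (rule tensor_lift_pure[OF vec_space_ground bilinear_evaluation])

lemma finite_dual_pairing_sum:
  assumes "\<And>i. i \<in> A \<Longrightarrow> g i \<in> vcarrier R0" "\<And>i. i \<in> A \<Longrightarrow> h i \<in> vcarrier R0"
  shows "finite_dual_pairing scale (\<Sum>i\<in>A. pure_tensor R0 R0 (g i) (h i)) a b = (\<Sum>i\<in>A. g i a * h i b)"
proof -
  have "finite_dual_pairing scale (\<Sum>i\<in>A. pure_tensor R0 R0 (g i) (h i)) a b =
    (\<Sum>i\<in>A. finite_dual_pairing scale (pure_tensor R0 R0 (g i) (h i)) a b)"
    using assms by (intro linear_map_sum[OF linear_finite_dual_pairing vec_space_tensor] pure_tensor_mem)
  then show ?thesis using assms by (simp add: finite_dual_pairing_pure)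
qed

lemma finite_dual_comult_exists:
  assumes "f \<in> vcarrier R0"
  shows "\<exists>t\<in>vcarrier (tensor R0 R0). \<forall>a b. finite_dual_pairing scale t a b = f (a * b)"
proof -
  obtain I where f: "Vector_Spaces.linear scale (*) f" and I: "algebra_ideal scale (*) I"
    "finite_codimension scale I" and fI: "\<forall>x\<in>I. f x = 0"
    using assms by (rule finite_dual_ideal)
  have sub: "subspace I" using I by (simp add: algebra_ideal_def)
  obtain B h where B: "finite B" and h: "\<forall>b\<in>B. Vector_Spaces.linear scale (*) (h b)"
    and hI: "\<forall>b\<in>B. \<forall>x\<in>I. h b x = 0"
    and coord: "\<forall>x. x - (\<Sum>b\<in>B. scale (h b x) b) \<in> I"
    by (rule finite_codimension_coordinates[OF vector_space_axioms sub I(2)])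
  define g where "g b = (\<lambda>a. f (a * b))" for b
  have hR: "h b \<in> vcarrier R0" if "b \<in> B" for b
    using that h hI I by (intro finite_dualI[of _ _ I]) auto
  have gR: "g b \<in> vcarrier R0" for b
  proof (rule finite_dualI[of _ _ I])
    show "Vector_Spaces.linear scale (*) (g b)"
      unfolding linear_iff g_def
      using vector_space_axioms vector_space_ground
      by (auto simp: linear_mem[OF f] algebra_simps scale_mult_left)
    show "g b x = 0" if "x \<in> I" for x
      using that I fI by (auto simp: g_def algebra_ideal_def)
  qed (use I in auto)
  show ?thesis
  proof (intro bexI allI)
    show "(\<Sum>b\<in>B. pure_tensor R0 R0 (g b) (h b)) \<in> vcarrier (tensor R0 R0)"
      using gR hR by (intro vec_space_sum[OF vec_space_tensor] pure_tensor_mem)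
    fix a x
    have "a * (x - (\<Sum>b\<in>B. scale (h b x) b)) \<in> I"
      using coord I by (simp add: algebra_ideal_def)
    then have "f (a * x - (\<Sum>b\<in>B. a * scale (h b x) b)) = 0"
      using fI by (simp add: right_diff_distrib sum_distrib_left)
    then have "f (a * x) = (\<Sum>b\<in>B. h b x * f (a * b))"
      by (simp add: linear_mem[OF f] scale_mult_right)
    then show "finite_dual_pairing scale (\<Sum>b\<in>B. pure_tensor R0 R0 (g b) (h b)) a x = f (a * x)"
      using gR hR by (subst finite_dual_pairing_sum) (auto simp: g_def mult.commute)
  qed
qed

end

lemma tensor_expansion:
  assumes V: "vec_space V" and B: "vcarrier W \<subseteq> module.span (vscale W) B" "B \<subseteq> vcarrier W"
    and W: "vec_space W" and t: "t \<in> vcarrier (tensor V W)"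
  shows "\<exists>F g. finite F \<and> F \<subseteq> B \<and> (\<forall>b. g b \<in> vcarrier V) \<and>
           t = (\<Sum>b\<in>F. pure_tensor V W (g b) b)"
proof -
  interpret W: vector_space "vscale W" using W by (simp add: vec_space_def)
  have add: "pure_tensor V W (v + v') w = pure_tensor V W v w + pure_tensor V W v' w"
    "pure_tensor V W v (w + w') = pure_tensor V W v w + pure_tensor V W v w'"
    "pure_tensor V W (vscale V c v) w = fscale c (pure_tensor V W v w)"
    "pure_tensor V W v (vscale W c w) = fscale c (pure_tensor V W v w)"
    if "v \<in> vcarrier V" "v' \<in> vcarrier V" "w \<in> vcarrier W" "w' \<in> vcarrier W" for v v' w w' c
    using that bilinear_pure_tensor[of V W] by (simp_all add: bilinear_map_def linear_map_def)
  have scale_left: "pure_tensor V W (vscale V c v) w = fscale c (pure_tensor V W v w)"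
    if "v \<in> vcarrier V" "w \<in> vcarrier W" for c v w
    using add(3) that by blast
  have zero: "pure_tensor V W 0 w = 0" if "w \<in> vcarrier W" for w
    using add(1)[of 0 0 w w] that vec_space_closed(1)[OF V] by simp
  have zeror: "pure_tensor V W v 0 = 0" if "v \<in> vcarrier V" for v
    using add(2)[of v v 0 0] that vec_space_closed(1)[OF W] by simp
  define rep where "rep t F g \<longleftrightarrow> finite F \<and> F \<subseteq> B \<and> (\<forall>b. g b \<in> vcarrier V) \<and>
      (\<forall>b. b \<notin> F \<longrightarrow> g b = 0) \<and> t = (\<Sum>b\<in>F. pure_tensor V W (g b) b)" for t F g
  have rep_zero: "rep 0 {} (\<lambda>_. 0)"
    using vec_space_closed(1)[OF V] by (simp add: rep_def)
  have rep_mono: "t = (\<Sum>b\<in>G. pure_tensor V W (g b) b)"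
    if "rep t F g" "F \<subseteq> G" "finite G" "G \<subseteq> B" for t F G g
  proof -
    have "(\<Sum>b\<in>F. pure_tensor V W (g b) b) = (\<Sum>b\<in>G. pure_tensor V W (g b) b)"
    proof (rule sum.mono_neutral_left)
      show "\<forall>b\<in>G - F. pure_tensor V W (g b) b = 0"
      proof
        fix b assume "b \<in> G - F"
        then have "g b = 0" "b \<in> vcarrier W" using that B by (auto simp: rep_def)
        then show "pure_tensor V W (g b) b = 0" using zero by simp
      qed
    qed (use that in auto)
    then show ?thesis using that(1) by (simp add: rep_def)
  qed
  have rep_add: "rep (s + t) (F \<union> G) (\<lambda>b. g b + h b)" if s: "rep s F g" and t: "rep t G h" for s t F G g h
  proof -
    have FG: "finite (F \<union> G)" "F \<union> G \<subseteq> B" using s t by (auto simp: rep_def)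
    have gV: "g b \<in> vcarrier V" "h b \<in> vcarrier V" for b using s t by (auto simp: rep_def)
    have "s + t = (\<Sum>b\<in>F \<union> G. pure_tensor V W (g b) b) + (\<Sum>b\<in>F \<union> G. pure_tensor V W (h b) b)"
      using rep_mono[OF s _ FG] rep_mono[OF t _ FG] by (intro arg_cong2[where f="(+)"]) auto
    also have "\<dots> = (\<Sum>b\<in>F \<union> G. pure_tensor V W (g b) b + pure_tensor V W (h b) b)"
      by (rule sum.distrib[symmetric])
    also have "\<dots> = (\<Sum>b\<in>F \<union> G. pure_tensor V W (g b + h b) b)"
    proof (rule sum.cong)
      fix b assume "b \<in> F \<union> G"
      then have b: "b \<in> vcarrier W" using FG B by blast
      show "pure_tensor V W (g b) b + pure_tensor V W (h b) b = pure_tensor V W (g b + h b) b"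
        by (rule add(1)[OF gV b b, symmetric])
    qed simp
    finally have "s + t = (\<Sum>b\<in>F \<union> G. pure_tensor V W (g b + h b) b)" .
    moreover have "g b + h b = 0" if "b \<notin> F \<union> G" for b using s t that by (simp add: rep_def)
    ultimately show ?thesis
      unfolding rep_def using FG vec_space_closed(2)[OF V gV] by (intro conjI allI impI)
  qed
  have rep_pure: "\<exists>F g. rep (pure_tensor V W v w) F g" if v: "v \<in> vcarrier V" and w: "w \<in> vcarrier W" for v w
  proof -
    have "w \<in> W.span B" using w B by blast
    then have "w \<in> vcarrier W \<and> (\<exists>F g. rep (pure_tensor V W v w) F g)"
    proof (induction rule: W.span_induct_alt[consumes 1, case_names base step])
      case base
      have "rep (pure_tensor V W v 0) {} (\<lambda>_. 0)"
        unfolding zeror[OF v] by (rule rep_zero)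
      then show ?case using vec_space_closed(1)[OF W] by blast
    next
      case (step c b y)
      have y: "y \<in> vcarrier W" using step by blast
      obtain F g where Fg: "rep (pure_tensor V W v y) F g" using step by blast
      have b: "b \<in> vcarrier W" "vscale W c b \<in> vcarrier W"
        using step B vec_space_closed(3)[OF W] by auto
      have "pure_tensor V W v (vscale W c b) = pure_tensor V W (vscale V c v) b"
        using add(3)[OF v v b(1) b(1), of c] add(4)[OF v v b(1) b(1), of c] by (rule trans[OF _ sym, rotated])
      then have "rep (pure_tensor V W v (vscale W c b)) {b} (\<lambda>x. if x = b then vscale V c v else 0)"
        using step(1) vec_space_closed(1)[OF V] vec_space_closed(3)[OF V v] unfolding rep_def by simp
      from rep_add[OF this Fg]
      have "\<exists>F g. rep (pure_tensor V W v (vscale W c b + y)) F g"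
        unfolding add(2)[OF v v b(2) y] by blast
      then show ?case using vec_space_closed(2)[OF W b(2) y] by blast
    qed
    then show ?thesis by blast
  qed
  have "\<exists>F g. rep t F g"
    using t
  proof (induction rule: tensor_induct)
    case zero
    show ?case using rep_zero by blast
  next
    case (add c v w t)
    have "vscale V c v \<in> vcarrier V" using vec_space_closed(3)[OF V add(1)] .
    then obtain F g where "rep (pure_tensor V W (vscale V c v) w) F g" using rep_pure add(2) by blast
    moreover have "pure_tensor V W (vscale V c v) w = fscale c (pure_tensor V W v w)"
      by (rule scale_left[OF add(1,2)])
    ultimately have "rep (fscale c (pure_tensor V W v w)) F g" by simp
    moreover obtain G h where "rep t G h" using add(4) by blast
    ultimately have "rep (fscale c (pure_tensor V W v w) + t) (F \<union> G) (\<lambda>b. g b + h b)"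
      by (rule rep_add)
    then show ?case by blast
  qed
  then obtain F g where "rep t F g" by blast
  then show ?thesis unfolding rep_def by (intro exI[of _ F] exI[of _ g] conjI) (elim conjE; assumption)+
qed

context unital_algebra
begin

lemma finite_dual_pairing_inject:
  assumes s: "s \<in> vcarrier (tensor R0 R0)" and t: "t \<in> vcarrier (tensor R0 R0)"
    and eq: "\<And>a b. finite_dual_pairing scale s a b = finite_dual_pairing scale t a b"
  shows "s = t"
proof -
  interpret F: vector_space "fscale :: 'k \<Rightarrow> ('r \<Rightarrow> 'k) \<Rightarrow> _" by (rule vector_space_fscale)
  have neg: "fscale (-1) t \<in> vcarrier (tensor R0 R0)"
    using vec_space_closed(3)[OF vec_space_tensor t, of "-1"] by simp
  let ?d = "s + fscale (-1) t"
  have d: "?d \<in> vcarrier (tensor R0 R0)"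
    using vec_space_closed(2)[OF vec_space_tensor s neg] .
  have "finite_dual_pairing scale ?d a b =
    finite_dual_pairing scale s a b + (-1) * finite_dual_pairing scale t a b" for a b
    using linear_mapD(2)[OF linear_finite_dual_pairing s neg]
      linear_mapD(3)[OF linear_finite_dual_pairing t, where c="-1"]
    by (simp add: ground_def)
  then have d0: "finite_dual_pairing scale ?d a b = 0" for a b using eq by simp
  obtain B where B: "B \<subseteq> vcarrier R0" "F.independent B" "vcarrier R0 \<subseteq> F.span B"
    using F.maximal_independent_subset[of "vcarrier R0"] by blast
  have B': "vcarrier R0 \<subseteq> module.span (vscale R0) B" using B(3) by simp
  obtain A g where A: "finite A" "A \<subseteq> B" "\<forall>b. g b \<in> vcarrier R0"
    and exp: "?d = (\<Sum>b\<in>A. pure_tensor R0 R0 (g b) b)"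
    using tensor_expansion[OF vec_space_finite_dual B' B(1) vec_space_finite_dual d] by blast
  have "g b a = 0" if "b \<in> A" for a b
  proof -
    have "(\<Sum>b\<in>A. fscale (g b a) b) x = 0" for x
    proof -
      have "(\<Sum>b\<in>A. fscale (g b a) b) x = (\<Sum>b\<in>A. g b a * b x)"
        by (simp add: sum_fun_apply)
      also have "\<dots> = finite_dual_pairing scale ?d a x"
        unfolding exp using A B by (subst finite_dual_pairing_sum) auto
      finally show ?thesis using d0 by simp
    qed
    then have "(\<Sum>b\<in>A. fscale (g b a) b) = 0" by (simp add: fun_eq_iff)
    then show ?thesis using F.independentD[OF B(2) A(1,2), of "\<lambda>b. g b a"] that by blast
  qed
  then have g0: "g b = 0" if "b \<in> A" for b using that by (simp add: fun_eq_iff)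
  have "pure_tensor R0 R0 0 b = 0" if "b \<in> vcarrier R0" for b
    using linear_map_zero[of R0 "tensor R0 R0" "\<lambda>v. pure_tensor R0 R0 v b"]
      bilinear_pure_tensor[of R0 R0] vec_space_finite_dual that
    unfolding bilinear_map_def by blast
  then have "?d = 0" unfolding exp using g0 A B by (intro sum.neutral) auto
  then show ?thesis by (simp add: fun_eq_iff)
qed

theorem finite_dual_comult:
  assumes "f \<in> vcarrier R0"
  shows "finite_dual_comult scale f \<in> vcarrier (tensor R0 R0)"
    and "finite_dual_pairing scale (finite_dual_comult scale f) a b = f (a * b)"
proof -
  have "\<exists>!t. t \<in> vcarrier (tensor R0 R0) \<and> (\<forall>a b. finite_dual_pairing scale t a b = f (a * b))"
  proof (rule ex_ex1I)
    show "\<exists>t. t \<in> vcarrier (tensor R0 R0) \<and> (\<forall>a b. finite_dual_pairing scale t a b = f (a * b))"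
      using finite_dual_comult_exists[OF assms] by blast
  qed (rule finite_dual_pairing_inject; simp)
  from theI'[OF this]
  show "finite_dual_comult scale f \<in> vcarrier (tensor R0 R0)"
    and "finite_dual_pairing scale (finite_dual_comult scale f) a b = f (a * b)"
    unfolding finite_dual_comult_def by blast+
qed

end

end

theory Submission
  imports Defs
begin

text \<open>
  \<open>P\<close> is an algebra homomorphism from \<open>R\<^sub>P\<close> to \<open>R\<close>, so the preimage under \<open>P\<close> of a cofinite ideal
  of \<open>R\<close> is a cofinite ideal of \<open>R\<^sub>P\<close>, hence of \<open>R\<close>; this gives \<open>P\<^sup>*(R\<^sup>\<circ>) \<subseteq> R\<^sup>\<circ>\<close>. An element of
  \<open>R\<^sup>\<circ> \<otimes> R\<^sup>\<circ>\<close> is determined by its pairings with the \<open>a \<otimes> b\<close>, and paired with \<open>a \<otimes> b\<close> the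
  identity for \<open>P\<^sup>*\<close> at \<open>f\<close> is \<open>f\<close> applied to the Rota-Baxter identity for \<open>P\<close> at \<open>a, b\<close>. For the
  coalgebra axioms one computes in coordinates \<open>h\<^sub>b\<close> modulo a cofinite ideal \<open>I\<close>: every \<open>f\<close> vanishing
  on \<open>I\<close> satisfies \<open>\<Delta> f = \<Sum>\<^sub>b f(- b) \<otimes> h\<^sub>b\<close>.
\<close>

section \<open>Linear and bilinear maps\<close>

lemma linear_map_id: "linear_map V V id"
  by (simp add: linear_map_def)

lemma linear_map_add:
  assumes "linear_map V W f" "linear_map V W g" "vec_space W"
  shows "linear_map V W (\<lambda>x. f x + g x)"
proof -
  interpret vector_space "vscale W" using assms(3) by (simp add: vec_space_def)
  show ?thesis
    using assms vec_space_closed(2)[OF assms(3)]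
    by (simp add: linear_map_def scale_right_distrib algebra_simps)
qed

lemma linear_map_scale:
  assumes "linear_map V W f" "vec_space W"
  shows "linear_map V W (\<lambda>x. vscale W c (f x))"
proof -
  interpret vector_space "vscale W" using assms(2) by (simp add: vec_space_def)
  show ?thesis
    using assms vec_space_closed(3)[OF assms(2)]
    by (simp add: linear_map_def scale_right_distrib mult.commute)
qed

lemma bilinear_mapD:
  assumes "bilinear_map V W X \<beta>"
  shows "v \<in> vcarrier V \<Longrightarrow> linear_map W X (\<beta> v)"
    and "w \<in> vcarrier W \<Longrightarrow> linear_map V X (\<lambda>v. \<beta> v w)"
  using assms by (simp_all add: bilinear_map_def)

text \<open>With \<open>pure_tensor\<close> as the outer map this supplies the bilinearity needed
  for \<open>tensor_map\<close> and for the inner lift of the associator.\<close>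

lemma bilinear_map_comp:
  assumes "bilinear_map V' W' X \<beta>" "linear_map V V' f" "linear_map W W' g"
  shows "bilinear_map V W X (\<lambda>v w. \<beta> (f v) (g w))"
  using assms unfolding bilinear_map_def linear_map_def by simp

section \<open>Maps between tensor products\<close>

lemma pure_tensor_sum_left:
  assumes "vec_space V" "\<And>i. i \<in> A \<Longrightarrow> g i \<in> vcarrier V" "w \<in> vcarrier W"
  shows "pure_tensor V W (\<Sum>i\<in>A. g i) w = (\<Sum>i\<in>A. pure_tensor V W (g i) w)"
  using linear_map_sum[OF bilinear_mapD(2)[OF bilinear_pure_tensor assms(3)] assms(1,2)] .

lemma pure_tensor_sum_right:
  assumes "vec_space W" "v \<in> vcarrier V" "\<And>i. i \<in> A \<Longrightarrow> g i \<in> vcarrier W"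
  shows "pure_tensor V W v (\<Sum>i\<in>A. g i) = (\<Sum>i\<in>A. pure_tensor V W v (g i))"
  using linear_map_sum[OF bilinear_mapD(1)[OF bilinear_pure_tensor assms(2)] assms(1,3)] .

lemma pure_tensor_scale_left:
  assumes "v \<in> vcarrier V" "w \<in> vcarrier W"
  shows "pure_tensor V W (vscale V c v) w = fscale c (pure_tensor V W v w)"
  using linear_mapD(3)[OF bilinear_mapD(2)[OF bilinear_pure_tensor assms(2)] assms(1)] by simp

lemma pure_tensor_scale_right:
  assumes "v \<in> vcarrier V" "w \<in> vcarrier W"
  shows "pure_tensor V W v (vscale W c w) = fscale c (pure_tensor V W v w)"
  using linear_mapD(3)[OF bilinear_mapD(1)[OF bilinear_pure_tensor assms(1)] assms(2)] by simp

lemma tensor_map: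
  assumes "linear_map V V' f" "linear_map W W' g"
  shows linear_tensor_map: "linear_map (tensor V W) (tensor V' W') (tensor_map V W V' W' f g)"
    and tensor_map_pure: "v \<in> vcarrier V \<Longrightarrow> w \<in> vcarrier W \<Longrightarrow>
      tensor_map V W V' W' f g (pure_tensor V W v w) = pure_tensor V' W' (f v) (g w)"
  using tensor_lift[OF vec_space_tensor bilinear_map_comp[OF bilinear_pure_tensor assms]]
  unfolding tensor_map_def by blast+

text \<open>The associator is a lift of a lift, so the outer one needs the inner lift
  \<open>?L x\<close> to depend linearly on \<open>x\<close>. Each \<open>?L x\<close> comes from a
  separate choice and is known only through its values on pure tensors. Linearity in
  \<open>x\<close> therefore goes through \<open>tensor_hom_eqI\<close>: for fixed \<open>x\<close>
  and \<open>y\<close> both sides are linear in \<open>t\<close> and agree on pure tensors.\<close>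

lemma tensor_assoc:
  assumes X: "vec_space X"
  shows linear_tensor_assoc:
      "linear_map (tensor (tensor V W) X) (tensor V (tensor W X)) (tensor_assoc V W X)"
    and tensor_assoc_pure:
      "v \<in> vcarrier V \<Longrightarrow> w \<in> vcarrier W \<Longrightarrow> x \<in> vcarrier X \<Longrightarrow>
       tensor_assoc V W X (pure_tensor (tensor V W) X (pure_tensor V W v w) x) =
       pure_tensor V (tensor W X) v (pure_tensor W X w x)"
proof -
  let ?T = "tensor V (tensor W X)"
  define \<gamma> where "\<gamma> = (\<lambda>x v w. pure_tensor V (tensor W X) v (pure_tensor W X w x))"
  let ?L = "\<lambda>x. tensor_lift V W ?T (\<gamma> x)"
  have bil: "bilinear_map V W ?T (\<gamma> x)" if "x \<in> vcarrier X" for x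
    using bilinear_map_comp[OF bilinear_pure_tensor linear_map_id
        bilinear_mapD(2)[OF bilinear_pure_tensor that], of V W]
    by (simp add: \<gamma>_def)
  note lin = linear_tensor_lift[OF vec_space_tensor bil]
  note pure = tensor_lift_pure[OF vec_space_tensor bil]
  have \<gamma>_lin: "linear_map X ?T (\<lambda>x. \<gamma> x v w)" if "v \<in> vcarrier V" "w \<in> vcarrier W" for v w
    using bilinear_mapD(1)[OF bilinear_pure_tensor that(2), of X]
      bilinear_mapD(1)[OF bilinear_pure_tensor that(1), of "tensor W X"]
    unfolding \<gamma>_def linear_map_def by simp
  have "linear_map X ?T (\<lambda>x. ?L x t)" if t: "t \<in> vcarrier (tensor V W)" for t
    unfolding linear_map_def
  proof (intro conjI ballI allI)
    fix x assume x: "x \<in> vcarrier X"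
    show "?L x t \<in> vcarrier ?T" using linear_mapD(1)[OF lin[OF x] t] .
  next
    fix x y assume x: "x \<in> vcarrier X" and y: "y \<in> vcarrier X"
    have xy: "x + y \<in> vcarrier X" using vec_space_closed(2)[OF X x y] .
    have "?L (x + y) t = (\<lambda>t. ?L x t + ?L y t) t"
    proof (rule tensor_hom_eqI[OF lin[OF xy] linear_map_add[OF lin[OF x] lin[OF y] vec_space_tensor]
          vec_space_tensor _ t])
      fix v w assume vw: "v \<in> vcarrier V" "w \<in> vcarrier W"
      show "?L (x + y) (pure_tensor V W v w) =
        ?L x (pure_tensor V W v w) + ?L y (pure_tensor V W v w)"
        unfolding pure[OF xy vw] pure[OF x vw] pure[OF y vw]
        by (rule linear_mapD(2)[OF \<gamma>_lin[OF vw] x y])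
    qed
    then show "?L (x + y) t = ?L x t + ?L y t" .
  next
    fix c x assume x: "x \<in> vcarrier X"
    have cx: "vscale X c x \<in> vcarrier X" using vec_space_closed(3)[OF X x] .
    have "?L (vscale X c x) t = (\<lambda>t. vscale ?T c (?L x t)) t"
    proof (rule tensor_hom_eqI[OF lin[OF cx] linear_map_scale[OF lin[OF x] vec_space_tensor]
          vec_space_tensor _ t])
      fix v w assume vw: "v \<in> vcarrier V" "w \<in> vcarrier W"
      show "?L (vscale X c x) (pure_tensor V W v w) = vscale ?T c (?L x (pure_tensor V W v w))"
        unfolding pure[OF cx vw] pure[OF x vw]
        by (rule linear_mapD(3)[OF \<gamma>_lin[OF vw] x])
    qed
    then show "?L (vscale X c x) t = vscale ?T c (?L x t)" .
  qed
  then have b: "bilinear_map (tensor V W) X ?T (\<lambda>t x. ?L x t)"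
    using lin unfolding bilinear_map_def by blast
  have assoc: "tensor_assoc V W X = tensor_lift (tensor V W) X ?T (\<lambda>t x. ?L x t)"
    unfolding tensor_assoc_def \<gamma>_def ..
  show "linear_map (tensor (tensor V W) X) ?T (tensor_assoc V W X)"
    unfolding assoc by (rule linear_tensor_lift[OF vec_space_tensor b])
  show "tensor_assoc V W X (pure_tensor (tensor V W) X (pure_tensor V W v w) x) =
       pure_tensor V (tensor W X) v (pure_tensor W X w x)"
    if "v \<in> vcarrier V" "w \<in> vcarrier W" "x \<in> vcarrier X"
    using that tensor_lift_pure[OF vec_space_tensor b pure_tensor_mem[OF that(1,2)] that(3)]
      pure[OF that(3,1,2)]
    unfolding assoc by (simp add: \<gamma>_def)
qed

section \<open>The finite dual is a coalgebra\<close>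

context unital_algebra
begin

text \<open>
  The set \<open>A\<close> is the annihilator of a cofinite ideal \<open>I\<close> on which \<open>f\<close> vanishes, and the \<open>h b\<close> are
  coordinates on the quotient by \<open>I\<close>.
\<close>

lemma finite_dual_coordinates:
  assumes "f \<in> vcarrier R0"
  obtains A B h where "f \<in> A" "A \<subseteq> vcarrier R0" "finite B" "\<And>b. b \<in> B \<Longrightarrow> h b \<in> A"
    and "\<And>g b. g \<in> A \<Longrightarrow> (\<lambda>a. g (a * b)) \<in> A"
    and "\<And>g x y. g \<in> A \<Longrightarrow> g (y * x) = (\<Sum>b\<in>B. h b x * g (y * b))"
proof -
  obtain I where f: "Vector_Spaces.linear scale (*) f" and I: "algebra_ideal scale (*) I"
    "finite_codimension scale I" and fI: "\<forall>x\<in>I. f x = 0"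
    using assms by (rule finite_dual_ideal)
  have sub: "subspace I" using I by (simp add: algebra_ideal_def)
  obtain B h where B: "finite B" and h: "\<forall>b\<in>B. Vector_Spaces.linear scale (*) (h b)"
    and hI: "\<forall>b\<in>B. \<forall>x\<in>I. h b x = 0"
    and coord: "\<forall>x. x - (\<Sum>b\<in>B. scale (h b x) b) \<in> I"
    by (rule finite_codimension_coordinates[OF vector_space_axioms sub I(2)])
  \<comment> \<open>The full annihilator of \<open>I\<close> also contains the coordinates
    \<open>h b\<close>, so the expansion below applies alike to \<open>f\<close>, to its translates
    and to the \<open>h b\<close>.\<close>
  let ?A = "{g. Vector_Spaces.linear scale (*) g \<and> (\<forall>x\<in>I. g x = 0)}"
  show ?thesis
  proof
    show "f \<in> ?A" using f fI by simp
    show "?A \<subseteq> vcarrier R0" using I by (auto intro: finite_dualI[of _ _ I])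
    show "finite B" by fact
    show "h b \<in> ?A" if "b \<in> B" for b using that h hI by simp
    show "(\<lambda>a. g (a * b)) \<in> ?A" if "g \<in> ?A" for g b
    proof -
      have g: "Vector_Spaces.linear scale (*) g" using that by simp
      have "Vector_Spaces.linear scale (*) (\<lambda>a. g (a * b))"
        unfolding linear_iff using vector_space_axioms vector_space_ground
        by (auto simp: linear_mem[OF g] algebra_simps scale_mult_left)
      then show ?thesis using that I by (auto simp: algebra_ideal_def)
    qed
    show "g (y * x) = (\<Sum>b\<in>B. h b x * g (y * b))" if "g \<in> ?A" for g x y
    proof -
      have g: "Vector_Spaces.linear scale (*) g" using that by simp
      \<comment> \<open>The difference of \<open>x\<close> and its coordinate sum lies in
        \<open>I\<close>; it stays there after multiplication by \<open>y\<close>, and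
        \<open>g\<close> kills it.\<close>
      have "y * (x - (\<Sum>b\<in>B. scale (h b x) b)) \<in> I"
        using coord I by (simp add: algebra_ideal_def)
      then have "g (y * x - (\<Sum>b\<in>B. y * scale (h b x) b)) = 0"
        using that by (simp add: right_diff_distrib sum_distrib_left)
      then show ?thesis by (simp add: linear_mem[OF g] scale_mult_right)
    qed
  qed
qed

lemma finite_dual_comult_eqI:
  assumes "f \<in> vcarrier R0" "t \<in> vcarrier (tensor R0 R0)"
    and "\<And>a b. finite_dual_pairing scale t a b = f (a * b)"
  shows "finite_dual_comult scale f = t"
  using assms finite_dual_comult by (intro finite_dual_pairing_inject) auto

lemma linear_finite_dual_comult: "linear_map R0 (tensor R0 R0) (finite_dual_comult scale)"
  unfolding linear_map_def
proof (intro conjI ballI allI)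
  fix f assume f: "f \<in> vcarrier R0"
  show "finite_dual_comult scale f \<in> vcarrier (tensor R0 R0)"
    using finite_dual_comult(1)[OF f] .
next
  fix f g assume f: "f \<in> vcarrier R0" and g: "g \<in> vcarrier R0"
  show "finite_dual_comult scale (f + g) = finite_dual_comult scale f + finite_dual_comult scale g"
    using linear_mapD(2)[OF linear_finite_dual_pairing finite_dual_comult(1)[OF f]
        finite_dual_comult(1)[OF g]]
      finite_dual_comult(2)[OF f] finite_dual_comult(2)[OF g]
    by (intro finite_dual_comult_eqI vec_space_closed(2)[OF vec_space_finite_dual f g]
        vec_space_closed(2)[OF vec_space_tensor finite_dual_comult(1)[OF f]
          finite_dual_comult(1)[OF g]]) simp
next
  fix c f assume f: "f \<in> vcarrier R0"
  show "finite_dual_comult scale (vscale R0 c f) =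
    vscale (tensor R0 R0) c (finite_dual_comult scale f)"
    using linear_mapD(3)[OF linear_finite_dual_pairing finite_dual_comult(1)[OF f], where c=c]
      finite_dual_comult(2)[OF f]
    by (intro finite_dual_comult_eqI vec_space_closed(3)[OF vec_space_finite_dual f]
        vec_space_closed(3)[OF vec_space_tensor finite_dual_comult(1)[OF f]]) (simp add: ground_def)
qed

text \<open>One finite family \<open>h\<close> serves for the whole computation, because
  \<open>A\<close> contains it and is stable under translation. Both sides of coassociativity become
  the sum over b, c, e in \<open>B\<close> of h_e(c b) f(- e) \<otimes> (h_c \<otimes> h_b).\<close>

theorem coalgebra_finite_dual:
  "coalgebra R0 (finite_dual_comult scale) finite_dual_counit"
proof
  show "vec_space R0" by (rule vec_space_finite_dual)
  show "linear_map R0 (tensor R0 R0) (finite_dual_comult scale)"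
    by (rule linear_finite_dual_comult)
  show "linear_map R0 ground finite_dual_counit"
    by (simp add: linear_map_def ground_def finite_dual_counit_def)
  let ?\<Delta> = "finite_dual_comult scale"
  let ?p = "pure_tensor R0 R0" and ?q = "pure_tensor R0 (tensor R0 R0)"
  fix f assume f: "f \<in> vcarrier R0"
  obtain A B h where A: "f \<in> A" "A \<subseteq> vcarrier R0" and B: "finite B"
    and h: "\<And>b. b \<in> B \<Longrightarrow> h b \<in> A"
    and tr: "\<And>g b. g \<in> A \<Longrightarrow> (\<lambda>a. g (a * b)) \<in> A"
    and coord: "\<And>g x y. g \<in> A \<Longrightarrow> g (y * x) = (\<Sum>b\<in>B. h b x * g (y * b))"
    using finite_dual_coordinates[OF f] by blast
  have hR: "h b \<in> vcarrier R0" if "b \<in> B" for b using h A that by blast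
  have trR: "(\<lambda>a. g (a * b)) \<in> vcarrier R0" if "g \<in> A" for g b using tr A that by blast
  have \<Delta>: "?\<Delta> g = (\<Sum>b\<in>B. ?p (\<lambda>a. g (a * b)) (h b))" if g: "g \<in> A" for g
  proof (rule finite_dual_comult_eqI)
    show "g \<in> vcarrier R0" using g A by blast
    show "(\<Sum>b\<in>B. ?p (\<lambda>a. g (a * b)) (h b)) \<in> vcarrier (tensor R0 R0)"
      using hR trR g by (intro vec_space_sum[OF vec_space_tensor] pure_tensor_mem)
    fix a x
    show "finite_dual_pairing scale (\<Sum>b\<in>B. ?p (\<lambda>a. g (a * b)) (h b)) a x = g (a * x)"
      using hR trR g by (subst finite_dual_pairing_sum) (simp_all add: coord[OF g, of a x, symmetric] mult.commute)
  qed
  \<comment> \<open>The target is arbitrary: the counit laws use it with \<open>R0\<close>,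
    coassociativity with two tensor products.\<close>
  have lift: "tensor_lift R0 R0 X \<beta> (?\<Delta> f) = (\<Sum>b\<in>B. \<beta> (\<lambda>a. f (a * b)) (h b))"
    if "vec_space X" "bilinear_map R0 R0 X \<beta>" for X :: "('k, 'x::ab_group_add) vspace" and \<beta>
    unfolding \<Delta>[OF A(1)] using hR trR A
    by (subst linear_map_sum[OF linear_tensor_lift[OF that] vec_space_tensor])
      (auto intro!: pure_tensor_mem sum.cong tensor_lift_pure[OF that])
  note distribs = algebra_simps fun_eq_iff
  have bl: "bilinear_map R0 R0 R0 (\<lambda>y z. vscale R0 (finite_dual_counit y) z)"
    using vec_space_closed[OF vec_space_finite_dual]
    unfolding bilinear_map_def linear_map_def by (auto simp: finite_dual_counit_def distribs)
  have br: "bilinear_map R0 R0 R0 (\<lambda>y z. vscale R0 (finite_dual_counit z) y)"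
    using vec_space_closed[OF vec_space_finite_dual]
    unfolding bilinear_map_def linear_map_def by (auto simp: finite_dual_counit_def distribs)
  \<comment> \<open>The two counit laws are the coordinate expansion of f(y x) at y = 1 and at x =
    1.\<close>
  show "tensor_lift R0 R0 R0 (\<lambda>y z. vscale R0 (finite_dual_counit y) z) (?\<Delta> f) = f"
    unfolding lift[OF vec_space_finite_dual bl]
    using coord[OF A(1), of 1, symmetric] by (simp add: fun_eq_iff sum_fun_apply finite_dual_counit_def mult.commute)
  show "tensor_lift R0 R0 R0 (\<lambda>y z. vscale R0 (finite_dual_counit z) y) (?\<Delta> f) = f"
    unfolding lift[OF vec_space_finite_dual br]
    using coord[OF A(1), of _ 1, symmetric] by (simp add: fun_eq_iff sum_fun_apply finite_dual_counit_def)

  \<comment> \<open>A translate of g is expanded in two ways: \<open>expand\<close> uses the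
    translates by elements of \<open>B\<close>, \<open>expand_h\<close> uses the coordinates
    themselves. The first treats the left tensor factor f(- c b), the second the factor h_e(- b) in
    the comultiplication of h_e.\<close>
  have expand: "(\<lambda>a. g (a * x)) = (\<Sum>e\<in>B. fscale (h e x) (\<lambda>a. g (a * e)))" if "g \<in> A" for g x
    using coord[OF that, of _ x, symmetric] by (simp add: fun_eq_iff sum_fun_apply)
  have expand_h: "(\<lambda>a. g (a * x)) = (\<Sum>d\<in>B. fscale (g (d * x)) (h d))" if "g \<in> A" for g x
    using coord[OF tr[OF that, of x], of 1, symmetric] by (simp add: fun_eq_iff sum_fun_apply mult.commute)
  note lin = bilinear_map_comp[OF bilinear_pure_tensor]
  have scR: "fscale c g \<in> vcarrier R0" if "g \<in> vcarrier R0" for c g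
    using vec_space_closed(3)[OF vec_space_finite_dual that] by simp

  have "tensor_assoc R0 R0 R0 (tensor_map R0 R0 (tensor R0 R0) R0 ?\<Delta> id (?\<Delta> f)) =
    tensor_assoc R0 R0 R0 (\<Sum>b\<in>B. pure_tensor (tensor R0 R0) R0 (?\<Delta> (\<lambda>a. f (a * b))) (h b))"
    unfolding tensor_map_def
    by (subst lift[OF vec_space_tensor lin[OF linear_finite_dual_comult linear_map_id]]) simp
  also have "\<dots> = (\<Sum>b\<in>B. \<Sum>c\<in>B. ?q (\<lambda>a. f (a * (c * b))) (?p (h c) (h b)))"
  proof -
    have "tensor_assoc R0 R0 R0 (pure_tensor (tensor R0 R0) R0 (?\<Delta> (\<lambda>a. f (a * b))) (h b)) =
      (\<Sum>c\<in>B. ?q (\<lambda>a. f (a * (c * b))) (?p (h c) (h b)))" if b: "b \<in> B" for b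
    proof -
      have m: "?p (\<lambda>a. f (a * (c * b))) (h c) \<in> vcarrier (tensor R0 R0)" if "c \<in> B" for c
        by (intro pure_tensor_mem trR A hR that)
      have "pure_tensor (tensor R0 R0) R0 (?\<Delta> (\<lambda>a. f (a * b))) (h b) =
        (\<Sum>c\<in>B. pure_tensor (tensor R0 R0) R0 (?p (\<lambda>a. f (a * (c * b))) (h c)) (h b))"
        unfolding \<Delta>[OF tr[OF A(1)]] mult.assoc
        using m hR[OF b] by (intro pure_tensor_sum_left vec_space_tensor)
      then show ?thesis
        using m hR trR A b
        by (simp add: linear_map_sum[OF linear_tensor_assoc[OF vec_space_finite_dual] vec_space_tensor]
            pure_tensor_mem tensor_assoc_pure[OF vec_space_finite_dual])
    qed
    moreover have "pure_tensor (tensor R0 R0) R0 (?\<Delta> (\<lambda>a. f (a * b))) (h b)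
      \<in> vcarrier (tensor (tensor R0 R0) R0)" if "b \<in> B" for b
      by (intro pure_tensor_mem finite_dual_comult trR A hR that)
    ultimately show ?thesis
      by (simp add: linear_map_sum[OF linear_tensor_assoc[OF vec_space_finite_dual] vec_space_tensor])
  qed
  \<comment> \<open>The product c b need not lie in \<open>B\<close>; expanding its translate moves
    the dependence on c b into the scalar h_e(c b).\<close>
  also have "\<dots> = (\<Sum>b\<in>B. \<Sum>c\<in>B. \<Sum>e\<in>B. fscale (h e (c * b)) (?q (\<lambda>a. f (a * e)) (?p (h c) (h b))))"
  proof (intro sum.cong refl)
    fix b c assume "b \<in> B" "c \<in> B"
    then have m: "?p (h c) (h b) \<in> vcarrier (tensor R0 R0)" by (intro pure_tensor_mem hR)
    show "?q (\<lambda>a. f (a * (c * b))) (?p (h c) (h b)) =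
      (\<Sum>e\<in>B. fscale (h e (c * b)) (?q (\<lambda>a. f (a * e)) (?p (h c) (h b))))"
      unfolding expand[OF A(1), of "c * b"]
      using m trR[OF A(1)] scR pure_tensor_scale_left[of _ R0 _ "tensor R0 R0"]
      by (subst pure_tensor_sum_left[OF vec_space_finite_dual]) auto
  qed
  \<comment> \<open>With e outermost, the first factor f(- e) is constant in b and c, and the inner
    double sum is the comultiplication of h_e.\<close>
  also have "\<dots> = (\<Sum>e\<in>B. \<Sum>b\<in>B. \<Sum>c\<in>B. fscale (h e (c * b)) (?q (\<lambda>a. f (a * e)) (?p (h c) (h b))))"
    by (subst (2) sum.swap, subst sum.swap, rule refl)
  also have "\<dots> = (\<Sum>e\<in>B. ?q (\<lambda>a. f (a * e)) (?\<Delta> (h e)))"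
  proof (intro sum.cong refl)
    fix e assume e: "e \<in> B"
    have "?\<Delta> (h e) = (\<Sum>b\<in>B. \<Sum>c\<in>B. fscale (h e (c * b)) (?p (h c) (h b)))"
      unfolding \<Delta>[OF h[OF e]]
    proof (intro sum.cong refl)
      fix b assume "b \<in> B"
      then show "?p (\<lambda>a. h e (a * b)) (h b) = (\<Sum>c\<in>B. fscale (h e (c * b)) (?p (h c) (h b)))"
        unfolding expand_h[OF h[OF e]]
        using hR scR pure_tensor_scale_left[of _ R0 _ R0]
        by (subst pure_tensor_sum_left[OF vec_space_finite_dual]) auto
    qed
    moreover have m: "fscale (h e (c * b)) (?p (h c) (h b)) \<in> vcarrier (tensor R0 R0)"
      if "b \<in> B" "c \<in> B" for b c
      using vec_space_closed(3)[OF vec_space_tensor pure_tensor_mem[OF hR[OF that(2)] hR[OF that(1)]]]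
      by simp
    ultimately show "(\<Sum>b\<in>B. \<Sum>c\<in>B. fscale (h e (c * b)) (?q (\<lambda>a. f (a * e)) (?p (h c) (h b)))) =
      ?q (\<lambda>a. f (a * e)) (?\<Delta> (h e))"
      using pure_tensor_scale_right[OF trR[OF A(1)], of "?p _ _" "tensor R0 R0"] hR
      by (simp add: pure_tensor_sum_right[OF vec_space_tensor trR[OF A(1)]]
          vec_space_sum[OF vec_space_tensor] pure_tensor_mem)
  qed
  also have "\<dots> = tensor_map R0 R0 R0 (tensor R0 R0) id ?\<Delta> (?\<Delta> f)"
    unfolding tensor_map_def
    by (subst lift[OF vec_space_tensor lin[OF linear_map_id linear_finite_dual_comult]]) simp
  finally show "tensor_assoc R0 R0 R0 (tensor_map R0 R0 (tensor R0 R0) R0 ?\<Delta> id (?\<Delta> f)) =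
    tensor_map R0 R0 R0 (tensor R0 R0) id ?\<Delta> (?\<Delta> f)" .
qed

section \<open>The dual operator\<close>

text \<open>Adjointness: both sides are linear in \<open>t\<close>, so pure tensors suffice, and
  there it is composition of functionals with \<open>p\<close> and \<open>q\<close>.\<close>

lemma finite_dual_pairing_tensor_map:
  assumes p: "linear_map R0 R0 (dual_operator p)" and q: "linear_map R0 R0 (dual_operator q)"
    and t: "t \<in> vcarrier (tensor R0 R0)"
  shows "finite_dual_pairing scale (tensor_map R0 R0 R0 R0 (dual_operator p) (dual_operator q) t) a b =
    finite_dual_pairing scale t (p a) (q b)"
proof (rule tensor_hom_eqI[OF _ linear_finite_dual_pairing vec_space_ground _ t])
  show "linear_map (tensor R0 R0) ground (\<lambda>t. finite_dual_pairing scale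
      (tensor_map R0 R0 R0 R0 (dual_operator p) (dual_operator q) t) a b)"
    using linear_tensor_map[OF p q] linear_finite_dual_pairing[of a b]
    unfolding linear_map_def by simp
  fix g h assume "g \<in> vcarrier R0" "h \<in> vcarrier R0"
  then show "finite_dual_pairing scale
      (tensor_map R0 R0 R0 R0 (dual_operator p) (dual_operator q) (pure_tensor R0 R0 g h)) a b =
    finite_dual_pairing scale (pure_tensor R0 R0 g h) (p a) (q b)"
    using linear_mapD(1)[OF p] linear_mapD(1)[OF q]
    by (simp add: tensor_map_pure[OF p q] finite_dual_pairing_pure) (simp add: dual_operator_def)
qed

end

text \<open>The subspace \<open>I\<close> contains the common kernel of finitely many functionals
  \<open>h b\<close>, so its preimage contains the common kernel of the functionals
  \<open>h b \<circ> P\<close>.\<close>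

lemma finite_codimension_vimage:
  fixes scale :: "'k::field \<Rightarrow> 'r::ab_group_add \<Rightarrow> 'r"
  assumes vs: "vector_space scale" and I: "module.subspace scale I" "finite_codimension scale I"
    and P: "Vector_Spaces.linear scale scale P"
  shows "finite_codimension scale (P -` I)"
proof -
  obtain B h where B: "finite B" and h: "\<forall>b\<in>B. Vector_Spaces.linear scale (*) (h b)"
    and coord: "\<forall>x. x - (\<Sum>b\<in>B. scale (h b x) b) \<in> I"
    by (rule finite_codimension_coordinates[OF vs I])
  interpret vector_space scale by fact
  have "x \<in> I" if "\<forall>b\<in>B. h b x = 0" for x
    using coord[rule_format, of x] that by simp
  then show ?thesis
    using B h P
    by (intro finite_codimension_functionals[OF vs, of "(\<lambda>b. h b \<circ> P) ` B"])
      (auto intro: Vector_Spaces.linear_compose)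
qed

section \<open>Stability of the finite dual under the dual operator\<close>

context rota_baxter_algebra
begin

lemma algebra_ideal_vimage:
  assumes "algebra_ideal scale (*) I"
  shows "algebra_ideal scale (double_product scale P wt) (P -` I)"
proof -
  interpret P: Vector_Spaces.linear scale scale P by (rule P_linear)
  have "P (double_product scale P wt x y) = P x * P y" for x y
    unfolding double_product_def by (simp add: P.add P.scale rota_baxter)
  moreover have "subspace (P -` I)"
    using assms unfolding algebra_ideal_def by (intro P.subspace_vimage) blast
  ultimately show ?thesis using assms by (simp add: algebra_ideal_def)
qed

lemma linear_dual_operator:
  assumes ideals: "\<And>I. algebra_ideal scale (double_product scale P wt) I \<Longrightarrow> algebra_ideal scale (*) I"
  shows "linear_map R0 R0 (dual_operator P)"
proof -
  have "dual_operator P f \<in> vcarrier R0" if dual: "f \<in> vcarrier R0" for f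
  proof -
    obtain I where f: "Vector_Spaces.linear scale (*) f" and I: "algebra_ideal scale (*) I"
      "finite_codimension scale I" and fI: "\<forall>x\<in>I. f x = 0"
      using dual by (rule finite_dual_ideal)
    show ?thesis
    proof (rule finite_dualI)
      show "Vector_Spaces.linear scale (*) (dual_operator P f)"
        unfolding dual_operator_def using P_linear f by (rule Vector_Spaces.linear_compose)
      \<comment> \<open>The hypothesis on ideals enters here: the preimage is a priori an ideal only
        for the double product.\<close>
      show "algebra_ideal scale (*) (P -` I)"
        by (rule ideals[OF algebra_ideal_vimage[OF I(1)]])
      show "finite_codimension scale (P -` I)"
        using I P_linear
        by (intro finite_codimension_vimage vector_space_axioms) (simp_all add: algebra_ideal_def)
    qed (use fI in \<open>simp add: dual_operator_def\<close>)
  qed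
  then show ?thesis by (simp add: linear_map_def dual_operator_def fun_eq_iff)
qed

end

section \<open>The Rota-Baxter identity on the finite dual\<close>

theorem theorem3p2:
  fixes scale :: "'k::field_char_0 \<Rightarrow> 'r::{ring, monoid_mult} \<Rightarrow> 'r"
    and P :: "'r \<Rightarrow> 'r" and l :: 'k
  assumes "rota_baxter_algebra scale P l"
    and "\<And>I. algebra_ideal scale (double_product scale P l) I \<Longrightarrow> algebra_ideal scale (*) I"
  shows "rota_baxter_coalgebra (finite_dual scale) (finite_dual_comult scale)
           finite_dual_counit (dual_operator P) l"
proof -
  interpret rota_baxter_algebra scale P l by fact
  interpret C: coalgebra R0 "finite_dual_comult scale" finite_dual_counit
    by (rule coalgebra_finite_dual)
  have P: "linear_map R0 R0 (dual_operator P)"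
    using assms(2) by (rule linear_dual_operator)
  \<comment> \<open>Writing the identity as a dual operator lets the adjointness lemma cover the
    one-sided maps id \<otimes> Q and Q \<otimes> id as well.\<close>
  have dual_id: "id = dual_operator (id :: 'r \<Rightarrow> 'r)"
    by (simp add: fun_eq_iff dual_operator_def)
  have I: "linear_map R0 R0 (dual_operator id)"
    using linear_map_id[of R0] unfolding dual_id .
  show ?thesis
  proof
    show "linear_map R0 R0 (dual_operator P)" by fact
    let ?\<Delta> = "finite_dual_comult scale"
    fix f assume f: "f \<in> vcarrier R0"
    have Pf: "dual_operator P f \<in> vcarrier R0" using linear_mapD(1)[OF P f] .
    note mem = finite_dual_comult(1)[OF f] finite_dual_comult(1)[OF Pf]
    note pair = finite_dual_comult(2)[OF f] finite_dual_comult(2)[OF Pf]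
    let ?PP = "tensor_map R0 R0 R0 R0 (dual_operator P) (dual_operator P) (?\<Delta> f)"
    let ?IP = "tensor_map R0 R0 R0 R0 (dual_operator id) (dual_operator P) (?\<Delta> (dual_operator P f))"
    let ?PI = "tensor_map R0 R0 R0 R0 (dual_operator P) (dual_operator id) (?\<Delta> (dual_operator P f))"
    let ?s = "fscale l (?\<Delta> (dual_operator P f))"
    have t: "?PP \<in> vcarrier (tensor R0 R0)" "?IP \<in> vcarrier (tensor R0 R0)"
      "?PI \<in> vcarrier (tensor R0 R0)" "?s \<in> vcarrier (tensor R0 R0)"
      using linear_mapD(1)[OF linear_tensor_map[OF P P] mem(1)]
        linear_mapD(1)[OF linear_tensor_map[OF I P] mem(2)]
        linear_mapD(1)[OF linear_tensor_map[OF P I] mem(2)]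
        vec_space_closed(3)[OF vec_space_tensor mem(2), of l]
      by simp_all
    note sum = vec_space_closed(2)[OF vec_space_tensor]
    have "?PP = ?IP + ?PI + ?s"
    proof (rule finite_dual_pairing_inject)
      show "?PP \<in> vcarrier (tensor R0 R0)" by (rule t)
      show "?IP + ?PI + ?s \<in> vcarrier (tensor R0 R0)" by (intro sum t)
      fix a b
      let ?pair = "\<lambda>t. finite_dual_pairing scale t a b"
      have "?pair ?PP = f (P a * P b)"
        by (simp add: finite_dual_pairing_tensor_map[OF P P mem(1)] pair)
      \<comment> \<open>The Rota-Baxter identity of \<open>P\<close> at \<open>a\<close>,
        \<open>b\<close>, seen through the linear form \<open>f\<close>.\<close>
      also have "\<dots> = f (P (a * P b)) + f (P (P a * b)) + l * f (P (a * b))"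
        using linear_mem(1,2)[OF finite_dual_linear[OF f]] by (simp add: rota_baxter)
      also have "\<dots> = ?pair ?IP + ?pair ?PI + ?pair ?s"
        using linear_mapD(3)[OF linear_finite_dual_pairing mem(2), where c=l]
        by (simp add: finite_dual_pairing_tensor_map[OF P I mem(2)]
            finite_dual_pairing_tensor_map[OF I P mem(2)] pair ground_def)
          (simp add: dual_operator_def)
      also have "\<dots> = ?pair (?IP + ?PI + ?s)"
        using linear_mapD(2)[OF linear_finite_dual_pairing sum[OF t(2,3)] t(4)]
          linear_mapD(2)[OF linear_finite_dual_pairing t(2,3)] by simp
      finally show "?pair ?PP = ?pair (?IP + ?PI + ?s)" .
    qed
    then show "?PP = tensor_map R0 R0 R0 R0 id (dual_operator P) (?\<Delta> (dual_operator P f)) +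
      tensor_map R0 R0 R0 R0 (dual_operator P) id (?\<Delta> (dual_operator P f)) + ?s"
      unfolding dual_id .
  qed
qed

end
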